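(* A number $N$ is an even perfect number if and only if $N=2^{p-1}(2^p-1)$ for some prime $p$, and $$2n-1\ \Big|\ \sum_{\substack{k=0\\ k\text{ even}}}^{\lfloor n/2\rfloor}(-1)^{\lfloor k/2\rfloor}\,\frac{\prod_{\lambda=0}^{\lfloor k/2\rfloor-1}\big(n^2-(4\lambda)^2\big)}{k!},$$ where $n:=2^{p-1}$.
   Context: A perfect number is a positive integer equal to the sum of its proper divisors. The empty product $\prod_{\lambda=0}^{-1}\big(n^2-(4\lambda)^2\big)$ is defined to be $1$. The symbol $a\mid b$ means that $a$ divides $b$.
   Formalization: The equivalence is stated for all N other than 6: for N = 6 (p = 2, n = 2) the sum equals 1 and 2n-1 = 3 does not divide it, although 6 is an even perfect number, so the printed claim fails there. *)

theory Defs
  imports Complex_Main "HOL-Computational_Algebra.Primes"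
begin

definition perfect :: "nat \<Rightarrow> bool" where
  "perfect n \<longleftrightarrow> n > 0 \<and> n = (\<Sum>d \<in> {d. d dvd n \<and> d \<noteq> n}. d)"

text \<open>The quotients by \<open>k!\<close> are exact rational quotients. For \<open>k = 0\<close> the product
  ranges over the empty set, hence is \<open>1\<close>.\<close>

definition even_index_sum :: "nat \<Rightarrow> rat" where
  "even_index_sum n =
     (\<Sum>k \<in> {k. k \<le> n div 2 \<and> even k}.
        (- 1) ^ (k div 2)
        * (\<Prod>j<k div 2. (of_nat n)\<^sup>2 - (4 * of_nat j)\<^sup>2) / fact k)"

text \<open>Divisibility in the integers, for a dividend given as a rational number. The relation
  \<open>dvd\<close> on type \<open>rat\<close> itself would be trivial, since there every nonzero number divides
  every number.\<close>

definition int_divides :: "int \<Rightarrow> rat \<Rightarrow> bool" where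
  "int_divides a q \<longleftrightarrow> (\<exists>b::int. q = of_int b \<and> a dvd b)"

text \<open>The number \<open>6 = 2\<^sup>1 (2\<^sup>2 - 1)\<close> is perfect, but the divisibility criterion fails for its
  exponent \<open>p = 2\<close>: there \<open>n = 2\<close>, the sum is \<open>1\<close>, and \<open>2n - 1 = 3\<close> does not divide it.
  Hence \<open>6\<close> has to be excluded from the characterization.\<close>

lemma perfect_6: "perfect 6"
proof -
  have "{d::nat. d dvd 6 \<and> d \<noteq> 6} = {1, 2, 3}"
  proof (intro set_eqI iffI)
    fix d :: nat
    assume d: "d \<in> {d. d dvd 6 \<and> d \<noteq> 6}"
    then have "d \<le> 6" by (auto dest: dvd_imp_le)
    then have "d \<in> {0, 1, 2, 3, 4, 5, 6}" by auto
    with d show "d \<in> {1, 2, 3}" by auto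
  qed auto
  then show ?thesis by (simp add: perfect_def)
qed

lemma criterion_fails_2: "\<not> int_divides (2 * 2 - 1) (even_index_sum 2)"
proof -
  have "{k::nat. k \<le> 1 \<and> even k} = {0}"
    by (auto simp: le_Suc_eq)
  then have "even_index_sum 2 = 1" by (simp add: even_index_sum_def)
  then show ?thesis by (simp add: int_divides_def)
qed

end

theory Submission
  imports Defs "HOL-Number_Theory.Pocklington" "HOL-Number_Theory.Quadratic_Reciprocity"
begin

text \<open>
  The criterion is the Lucas--Lehmer test in disguise. The sum is a terminating hypergeometric
  series: with \<open>n = 4 r\<close> it is \<open>\<Sum>j\<le>r. (-16)\<^sup>j \<Prod>l<j. (r\<^sup>2 - l\<^sup>2) / (2j)!\<close>, which is the
  expansion of the Chebyshev polynomial \<open>T\<^sub>r(1 - 2y)\<close> in powers of \<open>y\<close>, taken at \<open>y = 4\<close>. Hence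
  it equals \<open>T\<^sub>r(-7) = (-1)\<^sup>r T\<^sub>r(7) = (-1)\<^sup>r T\<^sub>2\<^sub>r(2)\<close>. Now \<open>T\<^sub>m(2)\<close> is the rational part
  of \<open>\<omega>\<^sup>m\<close> for the unit \<open>\<omega> = 2 + \<surd>3\<close> of \<open>\<int>[\<surd>3]\<close>, so that for \<open>n = 2\<^sup>p\<^sup>-\<^sup>1\<close> with
  \<open>p \<ge> 3\<close> the condition says that \<open>M = 2\<^sup>p - 1\<close> divides the rational part of \<open>\<omega>\<close> to the power
  \<open>2\<^sup>p\<^sup>-\<^sup>2\<close> (lemma \<open>even_index_sum_eq_omega_power\<close>). Up to a factor 2 this number is the term
  with index \<open>p - 2\<close> of the Lucas--Lehmer sequence \<open>4, 14, 194, \<dots>\<close>.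

  Since \<open>\<omega>\<close> has norm 1, for odd \<open>M\<close> this divisibility is the same as the congruence
  \<open>\<omega>\<^sup>N \<equiv> -1\<close> modulo \<open>M\<close> with \<open>N = 2\<^sup>p\<^sup>-\<^sup>1\<close>. If it holds, then modulo every divisor
  \<open>q > 1\<close> of \<open>M\<close> the order of \<open>\<omega>\<close> is exactly \<open>2\<^sup>p\<close>; as there are only \<open>q\<^sup>2 - 1\<close> nonzero
  residues, \<open>q\<^sup>2 > M\<close>, and \<open>M\<close> is prime. Conversely, if \<open>M\<close> is prime and \<open>p\<close> is odd, then 3 is a
  quadratic nonresidue modulo \<open>M\<close>, so the Frobenius map sends \<open>1 + \<surd>3\<close> to \<open>1 - \<surd>3\<close>, and
  \<open>(1 + \<surd>3)\<^sup>2 = 2\<omega>\<close> gives the congruence.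

  The statement then follows from the theorem of Euclid and Euler. The exponent \<open>p = 2\<close>, which the
  test does not cover, belongs to the number 6.
\<close>

section \<open>Even perfect numbers and Mersenne primes\<close>

definition divisor_sum :: "nat \<Rightarrow> nat" where
  "divisor_sum n = (\<Sum>d \<in> {d. d dvd n}. d)"

lemma perfect_iff_divisor_sum: "perfect n \<longleftrightarrow> n > 0 \<and> divisor_sum n = 2 * n"
proof (cases "n > 0")
  case True
  have "{d. d dvd n} = insert n {d. d dvd n \<and> d \<noteq> n}" by auto
  moreover have "finite {d. d dvd n \<and> d \<noteq> n}" using True by simp
  ultimately have "divisor_sum n = n + (\<Sum>d \<in> {d. d dvd n \<and> d \<noteq> n}. d)"
    by (simp add: divisor_sum_def)
  then show ?thesis by (auto simp: perfect_def)
qed (simp add: perfect_def)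

text \<open>The even divisors of \<open>2\<^sup>k\<^sup>+\<^sup>1 m\<close> are the doubles of the divisors of \<open>2\<^sup>k m\<close>, and the odd ones
  are the divisors of \<open>m\<close>.\<close>

lemma divisor_sum_power_two_mult:
  assumes "odd m"
  shows "divisor_sum (2 ^ k * m) = (2 ^ (k + 1) - 1) * divisor_sum m"
proof (induction k)
  case (Suc k)
  have m: "m > 0" using assms by (rule odd_pos)
  have split: "{d. d dvd 2 ^ Suc k * m} = {d. d dvd m} \<union> (*) 2 ` {d. d dvd 2 ^ k * m}"
  proof (intro Set.set_eqI iffI)
    fix d assume d: "d \<in> {d. d dvd 2 ^ Suc k * m}"
    show "d \<in> {d. d dvd m} \<union> (*) 2 ` {d. d dvd 2 ^ k * m}"
    proof (cases "even d")
      case True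
      then show ?thesis using d by (auto elim!: evenE)
    next
      case False
      then have "coprime d (2 ^ Suc k)" by simp
      then show ?thesis using d by (simp add: coprime_dvd_mult_right_iff)
    qed
  qed (auto intro: dvd_mult)
  have disj: "{d. d dvd m} \<inter> (*) 2 ` {d. d dvd 2 ^ k * m} = {}"
    using assms by (auto dest: dvd_mult_left)
  have "divisor_sum (2 ^ Suc k * m)
      = divisor_sum m + (\<Sum>d \<in> (*) 2 ` {d. d dvd 2 ^ k * m}. d)"
    unfolding divisor_sum_def split using m disj by (subst sum.union_disjoint) auto
  also have "(\<Sum>d \<in> (*) 2 ` {d. d dvd 2 ^ k * m}. d) = 2 * divisor_sum (2 ^ k * m)"
    by (subst sum.reindex) (auto simp: inj_on_def divisor_sum_def sum_distrib_left)
  also have "divisor_sum m + \<dots> = (1 + 2 * (2 ^ (k + 1) - 1)) * divisor_sum m"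
    by (simp only: Suc.IH distrib_right mult_1 mult.assoc)
  also have "1 + 2 * (2 ^ (k + 1) - 1) = (2::nat) ^ (Suc k + 1) - 1"
  proof -
    have "1 + 2 * (a - 1) = 2 * a - 1" if "a \<ge> 1" for a :: nat using that by arith
    from this[of "2 ^ (k + 1)"] show ?thesis by simp
  qed
  finally show ?case .
qed simp

lemma divisor_sum_prime: "prime q \<Longrightarrow> divisor_sum q = q + 1"
proof -
  assume q: "prime q"
  have "{d. d dvd q} = {1, q}" using q by (auto simp: prime_nat_iff)
  then show ?thesis using prime_gt_1_nat[OF q] by (simp add: divisor_sum_def)
qed

text \<open>A Mersenne number \<open>2\<^sup>a\<^sup>b - 1\<close> is divisible by \<open>2\<^sup>a - 1\<close>.\<close>

lemma prime_exponent_of_mersenne_prime: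
  assumes "prime (2 ^ p - 1 :: nat)"
  shows "prime p"
proof -
  have p: "p > 1"
  proof (rule ccontr)
    assume "\<not> p > 1"
    then have "p = 0 \<or> p = 1" by auto
    then show False using assms by auto
  qed
  have "d = 1 \<or> d = p" if "d dvd p" for d
  proof -
    from that obtain e where e: "p = d * e" by blast
    have "2 ^ d - 1 dvd ((2::int) ^ d) ^ e - 1"
      using one_diff_power_eq[of "(2::int) ^ d" e]
      by (metis dvd_triv_left dvd_minus_iff minus_diff_eq minus_dvd_iff)
    then have "int (2 ^ d - 1) dvd int (2 ^ p - 1)" by (simp add: e power_mult of_nat_diff)
    then have "2 ^ d - 1 dvd (2 ^ p - 1 :: nat)" by (simp only: of_nat_dvd_iff)
    then have "2 ^ d - 1 = (1::nat) \<or> 2 ^ d - 1 = (2 ^ p - 1 :: nat)"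
      using assms by (auto simp: prime_nat_iff)
    moreover have "(2::nat) ^ d \<ge> 1" "(2::nat) ^ p \<ge> 1" by simp_all
    ultimately have "(2::nat) ^ d = 2 ^ 1 \<or> (2::nat) ^ d = 2 ^ p"
      unfolding power_one_right by linarith
    then show ?thesis by (metis one_less_numeral_iff power_inject_exp semiring_norm(76))
  qed
  then show ?thesis using p by (auto simp: prime_nat_iff)
qed

text \<open>Euclid's direction is multiplicativity of the divisor sum. For Euler's direction write
  \<open>N = 2\<^sup>k m\<close> with \<open>m\<close> odd: perfection forces \<open>m = (2\<^sup>k\<^sup>+\<^sup>1 - 1) c\<close> with divisor sum \<open>m + c\<close>, so
  \<open>m\<close> has no divisors besides \<open>m\<close> and \<open>c\<close>. Therefore \<open>c = 1\<close> and \<open>m\<close> is prime.\<close>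

theorem even_perfect_iff:
  "even N \<and> perfect N \<longleftrightarrow>
    (\<exists>p. prime p \<and> prime (2 ^ p - 1 :: nat) \<and> N = 2 ^ (p - 1) * (2 ^ p - 1))"
proof
  assume N: "even N \<and> perfect N"
  then have "N > 0" "divisor_sum N = 2 * N" by (auto simp: perfect_iff_divisor_sum)
  obtain m where Nm: "N = 2 ^ multiplicity 2 N * m" "odd m"
    using multiplicity_decompose'[of N "2::nat"] \<open>N > 0\<close> by auto
  define k where "k = multiplicity 2 N"
  have k: "k > 0" using Nm N unfolding k_def by (cases "multiplicity 2 N = 0") auto
  define q :: nat where "q = 2 ^ (k + 1) - 1"
  have q1: "q + 1 = 2 ^ (k + 1)" by (simp add: q_def)
  have q3: "q \<ge> 3"
  proof -
    have "(2::nat) ^ 2 \<le> 2 ^ (k + 1)" using k by (intro power_increasing) auto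
    then show ?thesis using q1 by simp
  qed
  have m0: "m > 0" using Nm(2) by (rule odd_pos)
  have eq: "q * divisor_sum m = (q + 1) * m"
    using divisor_sum_power_two_mult[OF Nm(2), of k] \<open>divisor_sum N = 2 * N\<close> Nm(1) q1
    by (simp add: k_def q_def)
  have "coprime q (q + 1)" by simp
  then have "q dvd m" using eq by (metis coprime_dvd_mult_right_iff dvd_triv_left)
  then obtain c where c: "m = q * c" by blast
  have "q * divisor_sum m = q * (m + c)" using eq c by (simp add: algebra_simps)
  then have sm: "divisor_sum m = m + c" using q3 by simp
  have c0: "c > 0" and cm: "c < m" using m0 c q3 by auto
  have sub: "A \<subseteq> {d. d dvd m} \<Longrightarrow> (\<Sum>d\<in>A. d) \<le> m + c" for A
    unfolding sm[symmetric] divisor_sum_def using m0 by (intro sum_mono2) auto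
  have only: "d = m \<or> d = c" if "d dvd m" for d
  proof (rule ccontr)
    assume "\<not> (d = m \<or> d = c)"
    moreover have "d > 0" using that m0 by (auto intro: Nat.gr0I)
    ultimately show False using sub[of "{d, m, c}"] that c cm by auto
  qed
  have "c = 1" using only[of 1] cm c0 by auto
  then have mq: "m = q" using c by simp
  have "prime q" using only q3 mq \<open>c = 1\<close> by (auto simp: prime_nat_iff)
  then have "prime (k + 1)" unfolding q_def by (rule prime_exponent_of_mersenne_prime)
  moreover have "N = 2 ^ (k + 1 - 1) * (2 ^ (k + 1) - 1)"
    using Nm(1) mq by (simp add: k_def q_def)
  ultimately show "\<exists>p. prime p \<and> prime (2 ^ p - 1 :: nat) \<and> N = 2 ^ (p - 1) * (2 ^ p - 1)"
    using \<open>prime q\<close> unfolding q_def by blast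
next
  assume "\<exists>p. prime p \<and> prime (2 ^ p - 1 :: nat) \<and> N = 2 ^ (p - 1) * (2 ^ p - 1)"
  then obtain p where p: "prime p" "prime (2 ^ p - 1 :: nat)" "N = 2 ^ (p - 1) * (2 ^ p - 1)"
    by blast
  have "p \<ge> 2" using p(1) by (rule prime_ge_2_nat)
  have odd: "odd (2 ^ p - 1 :: nat)" using \<open>p \<ge> 2\<close> by (simp add: even_diff_nat)
  have "2 ^ p = 2 * (2::nat) ^ (p - 1)" using \<open>p \<ge> 2\<close> by (simp flip: power_Suc)
  moreover have "divisor_sum N = (2 ^ p - 1) * 2 ^ p"
    using divisor_sum_power_two_mult[OF odd, of "p - 1"] divisor_sum_prime[OF p(2)] p(3) \<open>p \<ge> 2\<close>
    by simp
  ultimately have "divisor_sum N = 2 * N" using p(3) by (simp add: algebra_simps)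
  then show "even N \<and> perfect N"
    using p \<open>p \<ge> 2\<close> one_less_power[of "2::nat" p] by (auto simp: perfect_iff_divisor_sum)
qed

section \<open>The ring \<open>\<int>[\<surd>3]\<close>\<close>

text \<open>A type of its own, rather than a subset of the reals, makes congruences modulo an integer
  available as divisibility in the ring, which here is divisibility of both coordinates.\<close>

datatype zsqrt3 = ZSqrt3 (rat_part: int) (surd_part: int)

instantiation zsqrt3 :: comm_ring_1
begin

definition "0 = ZSqrt3 0 0"
definition "1 = ZSqrt3 1 0"
definition "x + y = ZSqrt3 (rat_part x + rat_part y) (surd_part x + surd_part y)"
definition "- x = ZSqrt3 (- rat_part x) (- surd_part x)"
definition "x - y = ZSqrt3 (rat_part x - rat_part y) (surd_part x - surd_part y)"
definition "x * y = ZSqrt3 (rat_part x * rat_part y + 3 * surd_part x * surd_part y)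
  (rat_part x * surd_part y + surd_part x * rat_part y)"

instance
  by standard (simp_all add: zero_zsqrt3_def one_zsqrt3_def plus_zsqrt3_def uminus_zsqrt3_def
      minus_zsqrt3_def times_zsqrt3_def algebra_simps)

end

lemma zsqrt3_parts [simp]:
  "rat_part 0 = 0" "surd_part 0 = 0" "rat_part 1 = 1" "surd_part 1 = 0"
  "rat_part (x + y) = rat_part x + rat_part y" "surd_part (x + y) = surd_part x + surd_part y"
  "rat_part (x - y) = rat_part x - rat_part y" "surd_part (x - y) = surd_part x - surd_part y"
  "rat_part (- x) = - rat_part x" "surd_part (- x) = - surd_part x"
  "rat_part (x * y) = rat_part x * rat_part y + 3 * surd_part x * surd_part y"
  "surd_part (x * y) = rat_part x * surd_part y + surd_part x * rat_part y"
  by (simp_all add: zero_zsqrt3_def one_zsqrt3_def plus_zsqrt3_def uminus_zsqrt3_def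
      minus_zsqrt3_def times_zsqrt3_def)

lemma zsqrt3_parts_of_nat [simp]: "rat_part (of_nat n) = int n" "surd_part (of_nat n) = 0"
  by (induction n) simp_all

lemma zsqrt3_parts_of_int [simp]: "rat_part (of_int k) = k" "surd_part (of_int k) = 0"
  by (cases k rule: int_diff_cases; simp)+

lemma zsqrt3_parts_numeral [simp]:
  "rat_part (numeral w) = numeral w" "surd_part (numeral w) = 0"
  using zsqrt3_parts_of_int[of "numeral w"] by simp_all

lemma of_int_dvd_zsqrt3_iff: "of_int k dvd x \<longleftrightarrow> k dvd rat_part x \<and> k dvd surd_part x"
proof
  assume "of_int k dvd x"
  then show "k dvd rat_part x \<and> k dvd surd_part x" by (auto elim!: dvdE)
next
  assume "k dvd rat_part x \<and> k dvd surd_part x"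
  then obtain a b where "rat_part x = k * a" "surd_part x = k * b" by (auto elim!: dvdE)
  then have "x = of_int k * ZSqrt3 a b" by (simp add: zsqrt3.expand)
  then show "of_int k dvd x" by simp
qed

lemma of_nat_dvd_zsqrt3_iff: "of_nat n dvd x \<longleftrightarrow> int n dvd rat_part x \<and> int n dvd surd_part x"
  using of_int_dvd_zsqrt3_iff[of "int n" x] by simp

section \<open>A unit of order a power of two modulo an integer\<close>

lemma diff_dvd_diff_power: "x - y dvd x ^ n - y ^ n" for x y :: "'a::comm_ring_1"
proof (cases n)
  case (Suc m)
  then show ?thesis by (simp only: diff_power_eq_sum dvd_triv_left)
qed simp

text \<open>If \<open>u\<close> to the power \<open>2\<^sup>k\<close> is \<open>-1\<close> modulo \<open>q\<close>, then \<open>u\<close> has order \<open>2\<^sup>k\<^sup>+\<^sup>1\<close>: a smaller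
  positive exponent \<open>d = 2\<^sup>a b\<close> with \<open>b\<close> odd has \<open>a \<le> k\<close> and cannot give 1, because raising to the power
  \<open>2\<^sup>k\<^sup>-\<^sup>a\<close> would then give \<open>1 = (-1)\<^sup>b = -1\<close>, which fails for odd
  \<open>q > 1\<close>. Thus the powers of \<open>u\<close> occupy \<open>2\<^sup>k\<^sup>+\<^sup>1\<close> of the
  \<open>q\<^sup>2 - 1\<close> nonzero residues.\<close>

lemma power_two_order_bound:
  fixes u v :: zsqrt3 and q :: nat
  assumes unit: "u * v = 1" and q: "odd q" "q > 1"
    and neg1: "of_nat q dvd u ^ (2 ^ k) + 1"
  shows "2 ^ (k + 1) < q\<^sup>2"
proof -
  let ?q = "of_nat q :: zsqrt3"
  have unit_pow: "u ^ i * v ^ i = 1" for i by (simp add: unit flip: power_mult_distrib)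
  have not2: "\<not> ?q dvd 2"
  proof
    assume "?q dvd 2"
    then have "int q dvd int 2" by (simp add: of_nat_dvd_zsqrt3_iff)
    then have "q dvd 2" by (simp only: of_nat_dvd_iff)
    then have "q \<le> 2" by (rule dvd_imp_le) simp
    then show False using q by (cases "q = 2") auto
  qed
  have order: "\<not> ?q dvd u ^ d - 1" if d: "0 < d" "d < 2 ^ (k + 1)" for d
  proof
    assume q_dvd: "?q dvd u ^ d - 1"
    obtain b where b: "d = 2 ^ multiplicity 2 d * b" "odd b"
      using multiplicity_decompose'[of d "2::nat"] d by auto
    define a where "a = multiplicity 2 d"
    have db: "d = 2 ^ a * b" using b by (simp add: a_def)
    have "2 ^ a \<le> d" using db d by simp
    then have "(2::nat) ^ a < 2 ^ (k + 1)" using d by linarith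
    then have "a < k + 1" by (rule power_less_imp_less_exp[rotated]) simp
    then have exp: "d * 2 ^ (k - a) = 2 ^ k * b"
      by (simp add: db mult_ac flip: power_add)
    have "?q dvd (u ^ d) ^ (2 ^ (k - a)) - 1 ^ (2 ^ (k - a))"
      using q_dvd diff_dvd_diff_power dvd_trans by blast
    then have 1: "?q dvd u ^ (2 ^ k * b) - 1" by (simp add: exp flip: power_mult)
    have "?q dvd (u ^ (2 ^ k)) ^ b - (- 1) ^ b"
      using neg1 diff_dvd_diff_power[of "u ^ (2 ^ k)" "- 1" b] dvd_trans by fastforce
    then have "?q dvd u ^ (2 ^ k * b) + 1" using b(2) by (simp add: power_mult)
    from dvd_diff[OF this 1] show False using not2 by simp
  qed
  define f where "f i = (rat_part (u ^ i) mod int q, surd_part (u ^ i) mod int q)" for i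
  have not_cong: "f i \<noteq> f j" if "i < j" "j < 2 ^ (k + 1)" for i j
  proof
    assume "f i = f j"
    then have "?q dvd u ^ j - u ^ i"
      by (auto simp: f_def of_nat_dvd_zsqrt3_iff mod_eq_dvd_iff intro: dvd_diff_commute[THEN iffD1])
    moreover have "u ^ j = u ^ i * u ^ (j - i)" using that by (simp flip: power_add)
    ultimately have "?q dvd u ^ i * (u ^ (j - i) - 1)" by (simp add: algebra_simps)
    then have "?q dvd (u ^ i * v ^ i) * (u ^ (j - i) - 1)"
      by (metis dvd_mult2 mult.assoc mult.commute)
    then have "?q dvd u ^ (j - i) - 1" by (simp add: unit_pow)
    moreover have "0 < j - i" "j - i < 2 ^ (k + 1)" using that by linarith+
    ultimately show False using order by blast
  qed
  have "inj_on f {..<2 ^ (k + 1)}"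
    by (rule linorder_inj_onI) (use not_cong in auto)
  then have "2 ^ (k + 1) = card (f ` {..<2 ^ (k + 1)})" by (simp add: card_image)
  also have "\<dots> \<le> card ({0..<int q} \<times> {0..<int q} - {(0, 0)})"
  proof (rule card_mono)
    show "f ` {..<2 ^ (k + 1)} \<subseteq> {0..<int q} \<times> {0..<int q} - {(0, 0)}"
    proof
      fix y assume "y \<in> f ` {..<2 ^ (k + 1)}"
      then obtain i where i: "y = f i" by blast
      have "f i \<noteq> (0, 0)"
      proof
        assume "f i = (0, 0)"
        then have "?q dvd u ^ i" by (simp add: f_def of_nat_dvd_zsqrt3_iff mod_0_imp_dvd)
        then have "?q dvd u ^ i * v ^ i" by (rule dvd_mult2)
        then have "?q dvd 1 * 2" unfolding unit_pow by (rule dvd_mult2)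
        then show False using not2 by simp
      qed
      then show "y \<in> {0..<int q} \<times> {0..<int q} - {(0, 0)}" using i q by (auto simp: f_def)
    qed
  qed simp
  also have "\<dots> = q * q - 1" using q by (subst card_Diff_singleton) auto
  also have "\<dots> < q\<^sup>2" using q by (simp add: power2_eq_square)
  finally show ?thesis .
qed

section \<open>The Lucas--Lehmer test\<close>

text \<open>The fundamental unit \<open>2 + \<surd>3\<close>.\<close>

definition omega :: zsqrt3 where "omega = ZSqrt3 2 1"

definition omega_conj :: zsqrt3 where "omega_conj = ZSqrt3 2 (- 1)"

lemma omega_mult_conj: "omega * omega_conj = 1"
  by (simp add: zsqrt3.expand omega_def omega_conj_def)

lemma omega_power_norm: "(rat_part (omega ^ m))\<^sup>2 - 3 * (surd_part (omega ^ m))\<^sup>2 = 1"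
proof (induction m)
  case (Suc m)
  then show ?case by (simp add: omega_def power2_eq_square algebra_simps)
qed simp

text \<open>An element \<open>x\<close> of norm 1 satisfies \<open>x\<^sup>2 + 1 = t x\<close>, where \<open>t\<close> is its trace.\<close>

lemma omega_power_double_plus_one:
  "omega ^ (2 * m) + 1 = of_int (2 * rat_part (omega ^ m)) * omega ^ m"
  using omega_power_norm[of m]
  by (simp add: zsqrt3.expand power_mult power2_eq_square mult.commute[of 2 m] algebra_simps)

lemma dvd_rat_part_omega_power_iff:
  assumes "odd k"
  shows "k dvd rat_part (omega ^ m) \<longleftrightarrow> of_int k dvd omega ^ (2 * m) + 1"
proof
  assume "k dvd rat_part (omega ^ m)"
  then have "of_int k dvd (of_int (2 * rat_part (omega ^ m)) :: zsqrt3)"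
    by (simp add: of_int_dvd_zsqrt3_iff)
  then show "of_int k dvd omega ^ (2 * m) + 1"
    unfolding omega_power_double_plus_one by (rule dvd_mult2)
next
  assume "of_int k dvd omega ^ (2 * m) + 1"
  then have "of_int k dvd of_int (2 * rat_part (omega ^ m)) * omega ^ m * omega_conj ^ m"
    unfolding omega_power_double_plus_one by (rule dvd_mult2)
  also have "of_int (2 * rat_part (omega ^ m)) * omega ^ m * omega_conj ^ m
      = of_int (2 * rat_part (omega ^ m))"
    by (simp add: mult.assoc omega_mult_conj flip: power_mult_distrib)
  finally have "k dvd 2 * rat_part (omega ^ m)"
    unfolding of_int_dvd_zsqrt3_iff zsqrt3_parts_of_int by simp
  then show "k dvd rat_part (omega ^ m)" using assms by (simp add: coprime_dvd_mult_right_iff)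
qed

lemma mersenne_prime_if_dvd:
  assumes p: "p \<ge> 2" and dvd: "2 ^ p - 1 dvd rat_part (omega ^ 2 ^ (p - 2))"
  shows "prime (2 ^ p - 1 :: nat)"
proof (rule ccontr)
  define M :: nat where "M = 2 ^ p - 1"
  have intM: "int M = 2 ^ p - 1" by (simp add: M_def of_nat_diff)
  have "(2::nat) ^ 2 \<le> 2 ^ p" using p by (intro power_increasing) auto
  then have M: "M \<ge> 3" "odd M" using p by (auto simp: M_def even_diff_nat)
  assume "\<not> prime (2 ^ p - 1 :: nat)"
  then obtain d where d: "d dvd M" "d\<^sup>2 \<le> M" "d \<noteq> 1"
    using M prime_divisor_sqrt[of M] unfolding M_def[symmetric] by auto
  have "odd d" using d(1) M(2) dvd_trans by blast
  have "d > 1" using d M \<open>odd d\<close> by (cases "d = 0") auto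
  have "int d dvd rat_part (omega ^ 2 ^ (p - 2))"
    using d(1) dvd unfolding intM[symmetric] by (metis dvd_trans of_nat_dvd_iff)
  then have "of_nat d dvd omega ^ (2 * 2 ^ (p - 2)) + 1"
    using \<open>odd d\<close> dvd_rat_part_omega_power_iff[of "int d"] by simp
  moreover have "2 * 2 ^ (p - 2) = (2::nat) ^ (p - 1)" using p by (simp flip: power_Suc add: Suc_diff_le)
  ultimately have "2 ^ (p - 1 + 1) < d\<^sup>2"
    using power_two_order_bound[OF omega_mult_conj \<open>odd d\<close> \<open>d > 1\<close>, of "p - 1"] by simp
  then show False using d(2) p by (simp add: M_def)
qed

lemma prime_dvd_frobenius:
  fixes x y :: "'a::comm_ring_1"
  assumes q: "prime q"
  shows "of_nat q dvd (x + y) ^ q - x ^ q - y ^ q"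
proof -
  have q0: "q > 0" using q by (rule prime_gt_0_nat)
  have "(x + y) ^ q = (\<Sum>k\<in>{..q}. of_nat (q choose k) * x ^ k * y ^ (q - k))"
    by (rule binomial_ring)
  also have "{..q} = insert 0 (insert q {0<..<q})" using q0 by auto
  also have "(\<Sum>k\<in>\<dots>. of_nat (q choose k) * x ^ k * y ^ (q - k))
      = y ^ q + x ^ q + (\<Sum>k\<in>{0<..<q}. of_nat (q choose k) * x ^ k * y ^ (q - k))"
    using q0 by simp
  finally have eq: "(x + y) ^ q - x ^ q - y ^ q
      = (\<Sum>k\<in>{0<..<q}. of_nat (q choose k) * x ^ k * y ^ (q - k))" by simp
  show ?thesis unfolding eq
  proof (intro dvd_sum)
    fix k assume "k \<in> {0<..<q}"
    then have "q dvd q choose k" using q by (intro dvd_choose_prime) auto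
    then obtain c where "q choose k = q * c" by blast
    then show "of_nat q dvd of_nat (q choose k) * x ^ k * y ^ (q - k)"
      by (simp add: mult.assoc)
  qed
qed

text \<open>Both \<open>M\<close> and 3 are 3 modulo 4, and \<open>M\<close> is 1 modulo 3, hence a square there. By reciprocity 3
  is not a square modulo \<open>M\<close>.\<close>

lemma three_power_mod_mersenne_prime:
  fixes M :: nat
  assumes p: "odd p" "p \<ge> 3" and M: "M = 2 ^ p - 1" and prime: "prime M"
  shows "[3 ^ ((M - 1) div 2) = - 1] (mod int M)"
proof -
  have "(2::nat) ^ 3 \<le> 2 ^ p" using p by (intro power_increasing) auto
  then have M7: "M \<ge> 7" using M by simp
  obtain e where e: "p = 2 * e + 1" using p(1) by (rule oddE)
  have "[4 ^ e = 1 ^ e] (mod (3::int))" by (intro cong_pow) (simp add: cong_def)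
  then have "[2 * 4 ^ e - 1 = 2 * 1 - 1] (mod (3::int))"
    by (intro cong_diff cong_mult) simp_all
  moreover have intM: "int M = 2 * 4 ^ e - 1"
    using e by (simp add: M of_nat_diff power_mult)
  ultimately have M3: "[int M = 1] (mod 3)" by simp
  have e0: "e > 0" using e p(2) by auto
  have oddexp: "odd ((M - 1) div 2)"
  proof -
    have "(4::nat) ^ e = 4 * 4 ^ (e - 1)" using e0 by (simp flip: power_Suc)
    then have "M - 1 = 2 * (2 * (2 * 4 ^ (e - 1) - 1) + 1)"
      using M7 e by (simp add: M power_mult)
    then show ?thesis by simp
  qed
  have "Legendre (int 3) (int M) * Legendre (int M) (int 3) = (- 1) ^ ((3 - 1) div 2 * ((M - 1) div 2))"
    by (rule Quadratic_Reciprocity) (use prime M7 in auto)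
  also have "\<dots> = - 1" using oddexp by simp
  also have "Legendre (int M) (int 3) = 1"
  proof -
    have "\<not> [int M = 0] (mod 3)" using M3 by (simp add: cong_def)
    moreover have "QuadRes 3 (int M)"
      unfolding QuadRes_def by (rule exI[of _ 1]) (use M3 in \<open>simp add: cong_sym\<close>)
    ultimately show ?thesis by (simp add: Legendre_def)
  qed
  finally have "Legendre 3 (int M) = - 1" by simp
  then show ?thesis using euler_criterion[of M 3] prime M7 by (simp add: cong_sym)
qed

text \<open>Here \<open>2\<close> has order \<open>p\<close> modulo \<open>M = 2\<^sup>p - 1\<close>, and \<open>p\<close> divides
  \<open>(M - 1) / 2 = 2\<^sup>p\<^sup>-\<^sup>1 - 1\<close> by Fermat's theorem.\<close>

lemma two_power_mod_mersenne:
  fixes M :: nat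
  assumes p: "prime p" "odd p" and M: "M = 2 ^ p - 1"
  shows "[2 ^ ((M - 1) div 2) = 1] (mod int M)"
proof -
  have p2: "p \<ge> 2" using p(1) by (rule prime_ge_2_nat)
  have "\<not> p dvd 2" using p p2 by (metis dvd_imp_le even_numeral le_antisym zero_less_numeral)
  then have "[2 ^ (p - 1) = 1] (mod p)" by (rule fermat_theorem[OF p(1)])
  then have "p dvd 2 ^ (p - 1) - 1" by (rule cong_to_1_nat)
  moreover have "(M - 1) div 2 = 2 ^ (p - 1) - 1"
  proof -
    have "2 ^ p = 2 * (2::nat) ^ (p - 1)" using p2 by (simp flip: power_Suc)
    then show ?thesis by (simp add: M)
  qed
  ultimately obtain t where t: "(M - 1) div 2 = p * t" by auto
  have "[2 ^ p = 1] (mod int M)" by (simp add: M cong_iff_dvd_diff of_nat_diff)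
  then have "[(2 ^ p) ^ t = 1 ^ t] (mod int M)" by (rule cong_pow)
  then show ?thesis unfolding t by (simp add: power_mult)
qed

text \<open>Put \<open>s = \<surd>3\<close>. Modulo the prime \<open>M\<close> the Frobenius map sends \<open>1 + s\<close> to \<open>1 - s\<close>, so
  \<open>(1 + s)\<close> to the power \<open>M + 1\<close> is \<open>1 - s\<^sup>2 = -2\<close>. On the other hand it is
  \<open>(2\<omega>)\<close> to the power \<open>(M + 1) / 2 = 2\<^sup>p\<^sup>-\<^sup>1\<close>, and there the factor 2 contributes just 2.\<close>

lemma dvd_if_mersenne_prime:
  assumes p: "prime p" "odd p" and prime: "prime (2 ^ p - 1 :: nat)"
  shows "2 ^ p - 1 dvd rat_part (omega ^ 2 ^ (p - 2))"
proof -
  have p3: "p \<ge> 3" using prime_ge_2_nat[OF p(1)] p(2) by (cases "p = 2") auto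
  define M :: nat where "M = 2 ^ p - 1"
  define h where "h = (M - 1) div 2"
  let ?M = "of_nat M :: zsqrt3"
  let ?s = "ZSqrt3 0 1"
  have pp: "2 ^ p = 2 * (2::nat) ^ (p - 1)" using p3 by (simp flip: power_Suc)
  have hM: "M = 2 * h + 1" and h1: "h + 1 = 2 ^ (p - 1)"
    using pp one_le_power[of "2::nat" "p - 1"] unfolding M_def h_def by arith+
  have oddM: "odd (int M)" using hM by simp
  have primeM: "prime M" using prime by (simp add: M_def)
  have lift: "?M dvd of_int a - of_int b" if "[a = b] (mod int M)" for a b
    using that by (simp add: of_nat_dvd_zsqrt3_iff cong_iff_dvd_diff)
  have "?M dvd of_int (3 ^ h) - of_int (- 1)"
    by (rule lift) (use three_power_mod_mersenne_prime[OF p(2) p3 M_def primeM] in \<open>simp add: h_def\<close>)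
  then have three: "?M dvd 3 ^ h + 1" by simp
  have "?M dvd of_int (2 ^ h) - of_int 1"
    by (rule lift) (use two_power_mod_mersenne[OF p M_def] in \<open>simp add: h_def\<close>)
  then have two: "?M dvd 2 ^ h - 1" by simp
  have s2: "?s ^ 2 = 3" by (simp add: zsqrt3.expand power2_eq_square)
  have "?s ^ M = 3 ^ h * ?s" unfolding hM by (simp add: power_mult s2)
  moreover have "?M dvd (1 + ?s) ^ M - 1 ^ M - ?s ^ M"
    using prime_dvd_frobenius[OF primeM, of "1 :: zsqrt3" ?s] by simp
  ultimately have "?M dvd ((1 + ?s) ^ M - 1 - 3 ^ h * ?s) + (3 ^ h + 1) * ?s"
    using dvd_add dvd_mult2[OF three] by simp
  then have frob: "?M dvd (1 + ?s) ^ M - (1 - ?s)" by (simp add: algebra_simps)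
  have norm: "(1 - ?s) * (1 + ?s) = - 2" by (simp add: zsqrt3.expand)
  have "?M dvd ((1 + ?s) ^ M - (1 - ?s)) * (1 + ?s)" using frob by (rule dvd_mult2)
  moreover have "((1 + ?s) ^ M - (1 - ?s)) * (1 + ?s) = (1 + ?s) ^ (M + 1) + 2"
    by (simp only: left_diff_distrib[of "(1 + ?s) ^ M" "1 - ?s"] norm power_add power_one_right diff_minus_eq_add)
  ultimately have A: "?M dvd (1 + ?s) ^ (M + 1) + 2" by simp
  have "(1 + ?s) ^ 2 = 2 * omega" by (simp add: zsqrt3.expand omega_def power2_eq_square)
  then have "(1 + ?s) ^ (2 * (h + 1)) = (2 * omega) ^ (h + 1)" by (simp only: power_mult)
  moreover have "M + 1 = 2 * (h + 1)" using hM by simp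
  ultimately have "(1 + ?s) ^ (M + 1) = 2 * 2 ^ h * omega ^ (h + 1)"
    by (simp only: power_mult_distrib power_add power_one_right) (simp add: mult_ac)
  then have "?M dvd (2 * 2 ^ h * omega ^ (h + 1) + 2) - (2 ^ h - 1) * (2 * omega ^ (h + 1))"
    using dvd_diff[OF A dvd_mult2[OF two]] by simp
  then have "?M dvd 2 * (omega ^ (h + 1) + 1)" by (simp add: algebra_simps)
  moreover have "?M dvd x" if "?M dvd 2 * x" for x
    using that oddM by (simp add: of_nat_dvd_zsqrt3_iff coprime_dvd_mult_right_iff)
  ultimately have "?M dvd omega ^ (h + 1) + 1" by blast
  moreover have "h + 1 = 2 * 2 ^ (p - 2)"
    using h1 p3 by (simp flip: power_Suc add: Suc_diff_le)
  ultimately have "?M dvd omega ^ (2 * 2 ^ (p - 2)) + 1" by (simp only:)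
  then have "int M dvd rat_part (omega ^ 2 ^ (p - 2))"
    using dvd_rat_part_omega_power_iff[OF oddM] by simp
  then show ?thesis by (simp add: M_def of_nat_diff)
qed

section \<open>The sum as a value of a Chebyshev polynomial\<close>

definition diff_squares_prod :: "nat \<Rightarrow> rat \<Rightarrow> rat" where
  "diff_squares_prod j x = (\<Prod>l<j. x\<^sup>2 - (of_nat l)\<^sup>2)"

lemma diff_squares_prod_minus: "diff_squares_prod j (- x) = diff_squares_prod j x"
  by (simp add: diff_squares_prod_def)

lemma diff_squares_prod_Suc:
  "diff_squares_prod (Suc j) x = diff_squares_prod j x * (x - of_nat j) * (x + of_nat j)"
  by (simp add: diff_squares_prod_def power2_eq_square algebra_simps)

text \<open>The product of index \<open>j + 1\<close> is \<open>x\<close> times the product of all \<open>x + i\<close> with \<open>|i| \<le> j\<close>, so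
  that a shift of \<open>x\<close> by one changes only the factor \<open>x\<close> and the factors at the ends.\<close>

lemma diff_squares_prod_shift:
  "x * diff_squares_prod (Suc j) (x + 1)
    = (x + 1) * (x + of_nat j + 1) * (x + of_nat j) * diff_squares_prod j x"
proof (induction j)
  case 0
  show ?case by (simp add: diff_squares_prod_def power2_eq_square)
next
  case (Suc j)
  have "x * diff_squares_prod (Suc (Suc j)) (x + 1)
      = (x * diff_squares_prod (Suc j) (x + 1)) * ((x - of_nat j) * (x + of_nat j + 2))"
    by (subst diff_squares_prod_Suc) (simp add: algebra_simps)
  also have "\<dots> = (x + 1) * (x + of_nat (Suc j) + 1) * (x + of_nat (Suc j)) *
      (diff_squares_prod j x * (x - of_nat j) * (x + of_nat j))"
    unfolding Suc.IH by (simp add: algebra_simps)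
  finally show ?case by (simp only: diff_squares_prod_Suc)
qed

text \<open>Both neighbours of \<open>x\<close> are expressed by the product of index \<open>j\<close> at \<open>x\<close>, which leaves an
  identity of polynomials in \<open>x\<close> and \<open>j\<close>. It is the three-term recurrence of the Chebyshev
  polynomials, read off coefficient by coefficient.\<close>

lemma diff_squares_prod_second_difference:
  assumes "x \<noteq> 0"
  shows "diff_squares_prod (Suc j) (x + 1) - 2 * diff_squares_prod (Suc j) x
      + diff_squares_prod (Suc j) (x - 1)
    = (2 * of_nat j + 2) * (2 * of_nat j + 1) * diff_squares_prod j x"
proof -
  let ?P = "diff_squares_prod j x" and ?j = "of_nat j :: rat"
  have up: "x * diff_squares_prod (Suc j) (x + 1) = (x + 1) * (x + ?j + 1) * (x + ?j) * ?P"
    by (rule diff_squares_prod_shift)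
  \<comment> \<open>The product is even in \<open>x\<close>, so the step down from \<open>x\<close> is the step up from \<open>-x\<close>.\<close>
  have "x * diff_squares_prod (Suc j) (x - 1) = - (- x * diff_squares_prod (Suc j) (- x + 1))"
    using diff_squares_prod_minus[of "Suc j" "x - 1"] by simp
  also have "\<dots> = - ((- x + 1) * (- x + ?j + 1) * (- x + ?j) * ?P)"
    by (simp only: diff_squares_prod_shift diff_squares_prod_minus)
  finally have down: "x * diff_squares_prod (Suc j) (x - 1)
    = - ((- x + 1) * (- x + ?j + 1) * (- x + ?j) * ?P)" .
  have "x * (diff_squares_prod (Suc j) (x + 1) - 2 * diff_squares_prod (Suc j) x
      + diff_squares_prod (Suc j) (x - 1))
    = (x + 1) * (x + ?j + 1) * (x + ?j) * ?P - 2 * x * (?P * (x - ?j) * (x + ?j))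
      - (- x + 1) * (- x + ?j + 1) * (- x + ?j) * ?P"
    by (simp only: distrib_left right_diff_distrib up down mult.left_commute[of x 2])
      (simp add: diff_squares_prod_Suc algebra_simps)
  also have "\<dots> = x * ((2 * ?j + 2) * (2 * ?j + 1) * ?P)" by (simp add: algebra_simps)
  finally show ?thesis using assms by simp
qed

text \<open>The coefficient of \<open>y\<^sup>j\<close> in \<open>T\<^sub>r(1 - 2y)\<close>, multiplied by \<open>4\<^sup>j\<close>.\<close>

definition chebyshev_term :: "nat \<Rightarrow> nat \<Rightarrow> rat" where
  "chebyshev_term r j = (- 16) ^ j * diff_squares_prod j (of_nat r) / fact (2 * j)"

lemma chebyshev_term_0: "chebyshev_term r 0 = 1"
  by (simp add: chebyshev_term_def diff_squares_prod_def)

lemma chebyshev_term_eq_0: "r < j \<Longrightarrow> chebyshev_term r j = 0"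
  by (auto simp: chebyshev_term_def diff_squares_prod_def)

lemma chebyshev_term_recurrence:
  "chebyshev_term (r + 2) (Suc j) - 2 * chebyshev_term (r + 1) (Suc j) + chebyshev_term r (Suc j)
    = - 16 * chebyshev_term (r + 1) j"
proof -
  let ?x = "of_nat (r + 1) :: rat"
  let ?c = "(- 16) ^ Suc j / fact (2 * Suc j) :: rat"
  have x: "of_nat (r + 2) = ?x + 1" "of_nat r = ?x - 1" by simp_all
  have "chebyshev_term (r + 2) (Suc j) - 2 * chebyshev_term (r + 1) (Suc j) + chebyshev_term r (Suc j)
    = ?c * (diff_squares_prod (Suc j) (?x + 1) - 2 * diff_squares_prod (Suc j) ?x
        + diff_squares_prod (Suc j) (?x - 1))"
    unfolding chebyshev_term_def x by (simp only: distrib_left right_diff_distrib) simp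
  also have "\<dots> = ?c * ((2 * of_nat j + 2) * (2 * of_nat j + 1) * diff_squares_prod j ?x)"
    by (subst diff_squares_prod_second_difference) auto
  also have "\<dots> = - 16 * chebyshev_term (r + 1) j"
  proof -
    have f: "(fact (2 * Suc j) :: rat) = (2 * of_nat j + 2) * (2 * of_nat j + 1) * fact (2 * j)"
      by (simp add: algebra_simps)
    have "(2 * of_nat j + 2 :: rat) \<noteq> 0" "(2 * of_nat j + 1 :: rat) \<noteq> 0"
      by (simp_all add: add_nonneg_eq_0_iff)
    moreover have "C / (a * b * F) * (a * b * P) = C * P / F" if "a \<noteq> 0" "b \<noteq> 0" for a b C F P :: rat
      using that by simp
    ultimately show ?thesis unfolding chebyshev_term_def f by simp
  qed
  finally show ?thesis .
qed

definition chebyshev_sum :: "nat \<Rightarrow> rat" where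
  "chebyshev_sum r = (\<Sum>j\<le>r. chebyshev_term r j)"

lemma chebyshev_sum_extend:
  assumes "r \<le> J"
  shows "chebyshev_sum r = (\<Sum>j\<le>J. chebyshev_term r j)"
  unfolding chebyshev_sum_def using assms
  by (intro sum.mono_neutral_left) (auto simp: chebyshev_term_eq_0)

text \<open>This is the recurrence \<open>T\<^sub>r\<^sub>+\<^sub>2(z) = 2 z T\<^sub>r\<^sub>+\<^sub>1(z) - T\<^sub>r(z)\<close> at \<open>z = -7\<close>.\<close>

lemma chebyshev_sum_recurrence:
  "chebyshev_sum (r + 2) = - 14 * chebyshev_sum (r + 1) - chebyshev_sum r"
proof -
  \<comment> \<open>The three sums have different lengths; padding with zero terms gives them a common range.\<close>
  have ext: "chebyshev_sum i = 1 + (\<Sum>j\<le>r + 1. chebyshev_term i (Suc j))" if "i \<le> r + 2" for i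
    using chebyshev_sum_extend[of i "Suc (r + 1)"] that
    by (simp only: sum.atMost_Suc_shift chebyshev_term_0)
  have "chebyshev_sum (r + 2) - 2 * chebyshev_sum (r + 1) + chebyshev_sum r
      = (\<Sum>j\<le>r + 1. chebyshev_term (r + 2) (Suc j) - 2 * chebyshev_term (r + 1) (Suc j)
          + chebyshev_term r (Suc j))"
    by (simp only: ext[of "r + 2"] ext[of "r + 1"] ext[of r] sum.distrib sum_subtractf
        flip: sum_distrib_left) simp
  also have "\<dots> = - 16 * chebyshev_sum (r + 1)"
    by (simp only: chebyshev_term_recurrence chebyshev_sum_def sum_distrib_left)
  finally show ?thesis by linarith
qed

lemma chebyshev_sum_eq_omega_power:
  "chebyshev_sum r = of_int ((- 1) ^ r * rat_part (omega ^ (2 * r)))"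
proof (induction r rule: induct_nat_012)
  case 0
  show ?case by (simp add: chebyshev_sum_def chebyshev_term_0)
next
  case 1
  show ?case
    by (simp add: chebyshev_sum_def chebyshev_term_def diff_squares_prod_def omega_def
        power2_eq_square fact_2)
next
  case (ge2 r)
  have "omega ^ (2 * (r + 2)) = omega ^ (2 * r) * (omega ^ 2) ^ 2"
    by (simp only: distrib_left power_add flip: power_mult)
  also have "(omega ^ 2) ^ 2 = 14 * omega ^ 2 - 1"
    by (simp add: zsqrt3.expand omega_def power2_eq_square)
  also have "omega ^ (2 * r) * \<dots> = 14 * omega ^ (2 * (r + 1)) - omega ^ (2 * r)"
    by (simp add: algebra_simps power_add power2_eq_square)
  finally have omega_rec: "rat_part (omega ^ (2 * (r + 2)))
      = 14 * rat_part (omega ^ (2 * (r + 1))) - rat_part (omega ^ (2 * r))" by simp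
  define a where "a i = rat_part (omega ^ (2 * i))" for i
  have "chebyshev_sum (r + 2) = - 14 * of_int ((- 1) ^ (r + 1) * a (r + 1)) - of_int ((- 1) ^ r * a r)"
    using ge2 unfolding chebyshev_sum_recurrence a_def by simp
  also have "\<dots> = of_int ((- 1) ^ (r + 2) * (14 * a (r + 1) - a r))"
    by (simp add: algebra_simps)
  finally show ?case using omega_rec by (simp add: a_def)
qed

lemma even_index_sum_eq_chebyshev_sum: "even_index_sum (4 * r) = chebyshev_sum r"
proof -
  have index: "{k. k \<le> 4 * r div 2 \<and> even k} = (*) 2 ` {..r}"
    by (auto elim!: evenE)
  have inj: "inj_on ((*) (2::nat)) {..r}" by (auto simp: inj_on_def)
  have prod: "(\<Prod>l<j. (of_nat (4 * r))\<^sup>2 - (4 * of_nat l)\<^sup>2)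
      = 16 ^ j * diff_squares_prod j (of_nat r)" for j
  proof -
    have "(\<Prod>l<j. (of_nat (4 * r))\<^sup>2 - (4 * of_nat l)\<^sup>2)
        = (\<Prod>l<j. 16 * ((of_nat r)\<^sup>2 - (of_nat l)\<^sup>2) :: rat)"
      by (intro prod.cong) (simp_all add: power_mult_distrib)
    then show ?thesis by (simp only: prod.distrib prod_constant card_lessThan diff_squares_prod_def)
  qed
  have "(-16::rat) ^ j = (- 1) ^ j * 16 ^ j" for j
    by (simp flip: power_mult_distrib)
  moreover have "2 * j div 2 = j" for j :: nat by simp
  ultimately show ?thesis
    unfolding even_index_sum_def index sum.reindex[OF inj] chebyshev_sum_def chebyshev_term_def
    by (simp only: o_def prod mult.assoc)
qed

lemma even_index_sum_eq_omega_power: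
  assumes "4 dvd n"
  shows "even_index_sum n = of_int ((- 1) ^ (n div 4) * rat_part (omega ^ (n div 2)))"
proof -
  obtain r where "n = 4 * r" using assms by blast
  then show ?thesis
    using even_index_sum_eq_chebyshev_sum[of r] chebyshev_sum_eq_omega_power[of r] by simp
qed

lemma int_divides_of_int: "int_divides a (of_int b) \<longleftrightarrow> a dvd b"
  by (auto simp: int_divides_def)

section \<open>The criterion\<close>

lemma criterion_iff_mersenne_prime:
  assumes p: "prime p" "p \<noteq> 2"
  shows "int_divides (2 * int (2 ^ (p - 1)) - 1) (even_index_sum (2 ^ (p - 1)))
    \<longleftrightarrow> prime (2 ^ p - 1 :: nat)"
proof -
  have p3: "p \<ge> 3" using prime_ge_2_nat[OF p(1)] p(2) by simp
  have odd: "odd p" using p prime_odd_nat p3 by auto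
  have n: "(2::nat) ^ (p - 1) = 2 * 2 ^ (p - 2)" "(2::nat) ^ (p - 1) = 4 * 2 ^ (p - 3)"
    using power_add[of "2::nat" 1 "p - 2"] power_add[of "2::nat" 2 "p - 3"] p3
    by (simp_all add: numeral_3_eq_3 numeral_2_eq_2 Suc_diff_Suc)
  have M: "2 * int (2 ^ (p - 1)) - 1 = 2 ^ p - 1" using p3 by (simp flip: power_Suc)
  have "4 dvd (2::nat) ^ (p - 1)" unfolding n(2) by (rule dvd_triv_left)
  moreover have "(2::nat) ^ (p - 1) div 2 = 2 ^ (p - 2)" unfolding n(1) by simp
  ultimately have "int_divides (2 * int (2 ^ (p - 1)) - 1) (even_index_sum (2 ^ (p - 1)))
      \<longleftrightarrow> 2 ^ p - 1 dvd rat_part (omega ^ 2 ^ (p - 2))"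
    unfolding M by (simp only: even_index_sum_eq_omega_power int_divides_of_int)
      (simp add: uminus_power_if)
  also have "\<dots> \<longleftrightarrow> prime (2 ^ p - 1 :: nat)"
    using mersenne_prime_if_dvd[of p] dvd_if_mersenne_prime[OF p(1) odd] p3 by auto
  finally show ?thesis .
qed

theorem theorem6:
  fixes N :: nat
  assumes "N \<noteq> 6"
  shows "even N \<and> perfect N \<longleftrightarrow>
    (\<exists>p::nat. prime p \<and> N = 2 ^ (p - 1) * (2 ^ p - 1) \<and>
       (let n = 2 ^ (p - 1) in int_divides (2 * int n - 1) (even_index_sum n)))"
proof -
  have not2: "p \<noteq> 2" if "N = 2 ^ (p - 1) * (2 ^ p - 1)" for p
    using that assms by (auto simp: power2_eq_square)
  show ?thesis
    unfolding even_perfect_iff Let_def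
    using criterion_iff_mersenne_prime not2 by blast
qed

end
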